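(* For every field $\mathbb F$, the graph parameter $\operatorname{pm}$ is not expressible as a graph homomorphism function over $\mathbb F$; that is, there is no $\mathbb F$-weighted graph $H$ such that $\operatorname{pm}(G)=\hom(G,H)$ for every graph $G$.
   Context: Graphs $G$ are finite, may have multiple edges but no loops. $\operatorname{pm}(G)=m\cdot 1\in\mathbb F$ (the sum of $m$ copies of $1$), where $m$ is the number of perfect matchings of $G$ (the empty graph has one perfect matching). An $\mathbb F$-weighted graph $H$ is given by $q=|V(H)|\ge0$, vertex weights $\alpha_1,\dots,\alpha_q\in\mathbb F\setminus\{0\}$ and a symmetric matrix $B=(\beta_{ij})\in\mathbb F^{q\times q}$; $\hom(G,H)=\sum_{\phi:V(G)\to[q]}\prod_{u\in V(G)}\alpha_{\phi(u)}\prod_{uv\in E(G)}\beta_{\phi(u)\phi(v)}$ (edges with multiplicity; empty products equal $1$). *)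

theory Defs
  imports "HOL-Library.FuncSet" "Jordan_Normal_Form.Matrix"
begin

text \<open>
  A multigraph has named edges, each with its set of endpoints; parallel edges are distinct
  edges with the same set of endpoints.
\<close>

record ('v, 'e) mgraph =
  verts :: "'v set"
  edges :: "'e set"
  ends :: "'e \<Rightarrow> 'v set"

definition finite_multigraph :: "('v, 'e) mgraph \<Rightarrow> bool" where
  "finite_multigraph G \<longleftrightarrow>
     finite (verts G) \<and> finite (edges G) \<and>
     (\<forall>e\<in>edges G. ends G e \<subseteq> verts G \<and> card (ends G e) = 2)"

definition perfect_matchings :: "('v, 'e) mgraph \<Rightarrow> 'e set set" where
  "perfect_matchings G = {M. M \<subseteq> edges G \<and> (\<forall>v\<in>verts G. \<exists>!e. e \<in> M \<and> v \<in> ends G e)}"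

definition pm :: "('v, 'e) mgraph \<Rightarrow> 'f::field" where
  "pm G = of_nat (card (perfect_matchings G))"

text \<open>The vertices of a weighted graph are the indices \<open>0, \<dots>, q - 1\<close> of its weight vector.\<close>

record 'f wgraph =
  vertex_weights :: "'f vec"
  edge_weights :: "'f mat"

definition wgraph_order :: "'f wgraph \<Rightarrow> nat" where
  "wgraph_order H = dim_vec (vertex_weights H)"

definition weighted_graph :: "'f::field wgraph \<Rightarrow> bool" where
  "weighted_graph H \<longleftrightarrow>
     (\<forall>i<wgraph_order H. vertex_weights H $ i \<noteq> 0) \<and>
     edge_weights H \<in> carrier_mat (wgraph_order H) (wgraph_order H) \<and>
     transpose_mat (edge_weights H) = edge_weights H"

text \<open>
  The factor contributed by an edge with endpoint set \<open>{u, v}\<close>; by symmetry of the edge weights it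
  does not depend on the order of the two endpoints (lemma \<open>edge_factor_doubleton\<close>).
\<close>

definition edge_factor :: "'f wgraph \<Rightarrow> ('v \<Rightarrow> nat) \<Rightarrow> 'v set \<Rightarrow> 'f" where
  "edge_factor H \<phi> S = (THE b. \<exists>u v. S = {u, v} \<and> u \<noteq> v \<and> b = edge_weights H $$ (\<phi> u, \<phi> v))"

definition hom_function :: "('v, 'e) mgraph \<Rightarrow> 'f::field wgraph \<Rightarrow> 'f" where
  "hom_function G H =
     (\<Sum>\<phi>\<in>verts G \<rightarrow>\<^sub>E {0..<wgraph_order H}.
        (\<Prod>u\<in>verts G. vertex_weights H $ \<phi> u) * (\<Prod>e\<in>edges G. edge_factor H \<phi> (ends G e)))"

lemma edge_factor_doubleton:
  assumes H: "weighted_graph H" and uv: "u \<noteq> v"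
    and u: "\<phi> u < wgraph_order H" and v: "\<phi> v < wgraph_order H"
  shows "edge_factor H \<phi> {u, v} = edge_weights H $$ (\<phi> u, \<phi> v)"
proof -
  have "edge_weights H $$ (\<phi> v, \<phi> u) = transpose_mat (edge_weights H) $$ (\<phi> u, \<phi> v)"
    using H u v unfolding weighted_graph_def by (subst index_transpose_mat) auto
  also have "\<dots> = edge_weights H $$ (\<phi> u, \<phi> v)"
    using H unfolding weighted_graph_def by simp
  finally have sym: "edge_weights H $$ (\<phi> v, \<phi> u) = edge_weights H $$ (\<phi> u, \<phi> v)" .
  show ?thesis
    unfolding edge_factor_def
  proof (rule the_equality)
    show "\<exists>x y. {u, v} = {x, y} \<and> x \<noteq> y \<and>
            edge_weights H $$ (\<phi> u, \<phi> v) = edge_weights H $$ (\<phi> x, \<phi> y)"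
      using uv by blast
  next
    fix b
    assume "\<exists>x y. {u, v} = {x, y} \<and> x \<noteq> y \<and> b = edge_weights H $$ (\<phi> x, \<phi> y)"
    then show "b = edge_weights H $$ (\<phi> u, \<phi> v)"
      using sym by (auto simp: doubleton_eq_iff)
  qed
qed

end

theory Submission
  imports Defs "HOL-Computational_Algebra.Polynomial"
begin

text \<open>
  The graph on two vertices joined by \<open>m\<close> parallel edges has exactly \<open>m\<close> perfect matchings, so a
  weighted graph \<open>H\<close> representing \<open>pm\<close> would give \<open>m = (\<Sum>i j. \<alpha>\<^sub>i \<alpha>\<^sub>j \<beta>\<^sub>i\<^sub>j ^ m)\<close> in the field
  for all \<open>m\<close>. By linearity, \<open>p'(1) = (\<Sum>i j. \<alpha>\<^sub>i \<alpha>\<^sub>j p(\<beta>\<^sub>i\<^sub>j))\<close> for every polynomial \<open>p\<close>. A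
  polynomial that vanishes at every \<open>\<beta>\<^sub>i\<^sub>j\<close> and has a simple root at \<open>1\<close> contradicts this, in any
  characteristic.
\<close>

lemma of_nat_not_power_sum:
  fixes w b :: "'i \<Rightarrow> 'f::field"
  assumes I: "finite I"
  shows "\<exists>m. of_nat m \<noteq> (\<Sum>i\<in>I. w i * b i ^ m)"
proof (rule ccontr)
  assume "\<not> ?thesis"
  then have eq: "of_nat m = (\<Sum>i\<in>I. w i * b i ^ m)" for m
    by blast
  \<comment> \<open>Both sides are linear in \<open>p\<close>; on the monomial of degree
    \<open>k\<close> they agree by \<open>eq\<close>, its derivative at 1 being
    \<open>of_nat k\<close>.\<close>
  have L: "poly (pderiv p) 1 = (\<Sum>i\<in>I. w i * poly p (b i))" for p
  proof -
    have "poly (pderiv p) 1 = poly (pderiv (\<Sum>k\<le>degree p. monom (coeff p k) k)) 1"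
      by (simp add: poly_as_sum_of_monoms)
    also have "\<dots> = (\<Sum>k\<le>degree p. coeff p k * of_nat k)"
      using higher_pderiv_sum[of 1 "\<lambda>k. monom (coeff p k) k" "{..degree p}"]
      by (simp add: poly_sum pderiv_monom poly_monom mult.commute)
    also have "\<dots> = (\<Sum>i\<in>I. \<Sum>k\<le>degree p. coeff p k * (w i * b i ^ k))"
      by (subst sum.swap) (simp add: eq sum_distrib_left)
    also have "\<dots> = (\<Sum>i\<in>I. w i * poly p (b i))"
      by (simp add: poly_altdef sum_distrib_left mult_ac)
    finally show ?thesis .
  qed
  \<comment> \<open>Leaving out the root 1 keeps \<open>poly r 1\<close> nonzero; the factor
    \<open>[:- 1, 1:]\<close> then restores it as a simple root, whether or not 1 is among the
    \<open>b i\<close>.\<close>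
  define r where "r = (\<Prod>c\<in>b ` I - {1}. [:- c, 1:])"
  have r1: "poly r 1 \<noteq> 0"
    using I by (auto simp: r_def poly_prod)
  have "poly ([:- 1, 1:] * r) (b i) = 0" if "i \<in> I" for i
    using that I by (cases "b i = 1") (auto simp: r_def poly_prod)
  then have "poly (pderiv ([:- 1, 1:] * r)) 1 = 0"
    unfolding L by (intro sum.neutral) (metis mult_zero_right)
  then show False
    \<comment> \<open>By the product rule the derivative at 1 is \<open>poly r 1\<close>.\<close>
    using r1 by (simp add: pderiv_mult pderiv_pCons del: mult_pCons_left)
qed

definition parallel_edges :: "nat \<Rightarrow> (nat, nat) mgraph" where
  "parallel_edges m = \<lparr>verts = {0, 1}, edges = {..<m}, ends = \<lambda>_. {0, 1}\<rparr>"

lemma finite_multigraph_parallel_edges: "finite_multigraph (parallel_edges m)"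
  by (simp add: finite_multigraph_def parallel_edges_def)

lemma perfect_matchings_parallel_edges:
  "perfect_matchings (parallel_edges m) = (\<lambda>e. {e}) ` {..<m}"
proof -
  \<comment> \<open>Every edge meets both vertices, so the matching condition at either one says
    that \<open>M\<close> is a singleton.\<close>
  have "(\<exists>!e. e \<in> M) \<longleftrightarrow> (\<exists>e. M = {e})" for M :: "nat set"
    by auto
  then show ?thesis
    by (auto simp: perfect_matchings_def parallel_edges_def)
qed

lemma pm_parallel_edges: "pm (parallel_edges m) = of_nat m"
  by (simp add: pm_def perfect_matchings_parallel_edges card_image)

lemma hom_function_parallel_edges:
  assumes "weighted_graph H"
  shows "hom_function (parallel_edges m) H =
    (\<Sum>\<phi>\<in>{0, 1 :: nat} \<rightarrow>\<^sub>E {0..<wgraph_order H}.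
      (vertex_weights H $ \<phi> 0 * vertex_weights H $ \<phi> 1) * (edge_weights H $$ (\<phi> 0, \<phi> 1)) ^ m)"
  unfolding hom_function_def
proof (rule sum.cong)
  fix \<phi> :: "nat \<Rightarrow> nat"
  assume \<phi>: "\<phi> \<in> {0, 1} \<rightarrow>\<^sub>E {0..<wgraph_order H}"
  have "edge_factor H \<phi> {0, 1} = edge_weights H $$ (\<phi> 0, \<phi> 1)"
    using PiE_mem[OF \<phi>, of 0] PiE_mem[OF \<phi>, of 1]
    by (simp add: edge_factor_doubleton[OF assms])
  then show "(\<Prod>u\<in>verts (parallel_edges m). vertex_weights H $ \<phi> u) *
      (\<Prod>e\<in>edges (parallel_edges m). edge_factor H \<phi> (ends (parallel_edges m) e)) =
    (vertex_weights H $ \<phi> 0 * vertex_weights H $ \<phi> 1) * (edge_weights H $$ (\<phi> 0, \<phi> 1)) ^ m"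
    by (simp add: parallel_edges_def)
qed (simp add: parallel_edges_def)

theorem theorem4p3:
  shows "\<not> (\<exists>H :: 'f::field wgraph. weighted_graph H \<and>
           (\<forall>G :: (nat, nat) mgraph. finite_multigraph G \<longrightarrow> pm G = hom_function G H))"
proof
  assume "\<exists>H :: 'f wgraph. weighted_graph H \<and>
           (\<forall>G :: (nat, nat) mgraph. finite_multigraph G \<longrightarrow> pm G = hom_function G H)"
  then obtain H :: "'f wgraph" where H: "weighted_graph H"
    and pm: "\<And>G :: (nat, nat) mgraph. finite_multigraph G \<Longrightarrow> pm G = hom_function G H"
    by blast
  have "\<exists>m. (of_nat m :: 'f) \<noteq> hom_function (parallel_edges m) H"
    unfolding hom_function_parallel_edges[OF H]
    \<comment> \<open>The maps \<phi> themselves serve as the index set, in place of pairs (i,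
      j).\<close>
    by (rule of_nat_not_power_sum) (intro finite_PiE; simp)
  then obtain m where "(of_nat m :: 'f) \<noteq> hom_function (parallel_edges m) H" ..
  with pm[OF finite_multigraph_parallel_edges, of m] show False
    by (simp add: pm_parallel_edges)
qed

end
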